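(* Let $(X,\|\cdot\|)$ be a Banach space and let $B\subset X$ be a symmetric compact convex set. For every $t\ge 0$, there is a map $\pi_t:B\to B$ such that: (i) $\pi_t(x)$ is a minimizer for Peetre's $K$-functional for every $x\in B$: $$K(t,x):=\inf_{y\in X}\{\|y\|_B+t\|x-y\|\}=\|\pi_t(x)\|_B+t\|x-\pi_t(x)\|.$$ (ii) The set of minimizers $B_t:=\{\pi_t(x):x\in B\}$ can be characterized as $$B_t=\{y\in B:\exists\,z\in X^*\mbox{ such that }\langle z,y\rangle=\|y\|_B,~\|z\|_B^*\le 1,~\|z\|^*\le t\}.$$ (iii) $\pi_t(x)=x$ for every $x\in B_t$.
   Context: $X$ is a real Banach space with dual $X^*$. The gauge of $B$ is $\|x\|_B:=\inf\{s\ge 0:x\in sB\}$ for $x\in X$ (equal to $+\infty$ if no such $s$ exists). For $z\in X^*$, $\|z\|_B^*:=\sup_{x\in B}\langle z,x\rangle$ and $\|z\|^*:=\sup_{\|x\|\le 1}\langle z,x\rangle$. *)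

theory Defs
  imports "HOL-Analysis.Analysis"
begin

text \<open>Gauges take values in the extended reals: the infimum of the empty set is \<open>\<infinity>\<close>.\<close>

definition minkowski_gauge :: "'a::real_vector set \<Rightarrow> 'a \<Rightarrow> ereal" where
  "minkowski_gauge B x = Inf {ereal s |s. 0 \<le> s \<and> x \<in> (\<lambda>b. s *\<^sub>R b) ` B}"

definition K_functional :: "'a::real_normed_vector set \<Rightarrow> real \<Rightarrow> 'a \<Rightarrow> ereal" where
  "K_functional B t x = (INF y. minkowski_gauge B y + ereal (t * norm (x - y)))"

text \<open>The supremum has no absolute value, so it is a dual seminorm only for symmetric \<open>B\<close>.
  The topological dual is the type of bounded linear functionals.\<close>

definition dual_gauge :: "'a::real_normed_vector set \<Rightarrow> ('a \<Rightarrow>\<^sub>L real) \<Rightarrow> ereal" where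
  "dual_gauge B z = (SUP x\<in>B. ereal (blinfun_apply z x))"

text \<open>The operator norm on the dual is the supremum over the closed unit ball.\<close>

lemma dual_gauge_unit_ball:
  fixes z :: "'a::real_normed_vector \<Rightarrow>\<^sub>L real"
  shows "dual_gauge {x. norm x \<le> 1} z = ereal (norm z)"
proof (rule antisym)
  show "dual_gauge {x. norm x \<le> 1} z \<le> ereal (norm z)"
    unfolding dual_gauge_def
  proof (rule SUP_least)
    fix x :: 'a assume "x \<in> {x. norm x \<le> 1}"
    then have "norm z * norm x \<le> norm z * 1"
      by (intro mult_left_mono) auto
    moreover have "blinfun_apply z x \<le> norm z * norm x"
      using norm_blinfun[of z x] by simp
    ultimately show "ereal (blinfun_apply z x) \<le> ereal (norm z)"
      by simp
  qed
next
  show "ereal (norm z) \<le> dual_gauge {x. norm x \<le> 1} z"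
  proof (rule ereal_le_real)
    fix r assume r: "dual_gauge {x. norm x \<le> 1} z \<le> ereal r"
    have le: "blinfun_apply z x \<le> r" if "norm x \<le> 1" for x
    proof -
      have "ereal (blinfun_apply z x) \<le> dual_gauge {x. norm x \<le> 1} z"
        unfolding dual_gauge_def using that by (intro SUP_upper) auto
      then have "ereal (blinfun_apply z x) \<le> ereal r" using r by (rule order_trans)
      then show ?thesis by simp
    qed
    have "norm z \<le> r"
    proof (rule norm_blinfun_bound)
      show "0 \<le> r" using le[of 0] by (simp add: blinfun.zero_right)
      fix x :: 'a
      show "norm (blinfun_apply z x) \<le> r * norm x"
      proof (cases "x = 0")
        case False
        have "blinfun_apply z (x /\<^sub>R norm x) \<le> r" "blinfun_apply z (- (x /\<^sub>R norm x)) \<le> r"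
          using False by (intro le; simp)+
        then have "\<bar>blinfun_apply z x\<bar> / norm x \<le> r"
          by (auto simp: blinfun.scaleR_right blinfun.minus_right abs_if divide_inverse_commute)
        then show ?thesis using False by (simp add: divide_le_eq)
      qed (simp add: blinfun.zero_right)
    qed
    then show "ereal (norm z) \<le> ereal r" by simp
  qed
qed

end

theory Submission
  imports Defs
begin

text \<open>
  If \<open>y\<close> minimises \<open>\<lambda>y. \<parallel>y\<parallel>\<^sub>B + t \<parallel>x - y\<parallel>\<close>, then by the triangle inequality \<open>y\<close> is also a minimiser
  for the point \<open>y\<close> itself, that is, \<open>K(t, y) = \<parallel>y\<parallel>\<^sub>B\<close>. For nonempty \<open>B\<close> the function \<open>K(t, \<cdot>)\<close> is
  finite and sublinear on the whole space, and it lies below both \<open>\<parallel>\<cdot>\<parallel>\<^sub>B\<close> and \<open>t \<parallel>\<cdot>\<parallel>\<close>.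
  A linear functional \<open>z \<le> K(t, \<cdot>)\<close> touching it at \<open>y\<close>, which exists by Hahn--Banach (\<open>sublinear_has_supporting_functional\<close>), is
  therefore bounded with \<open>\<parallel>z\<parallel> \<le> t\<close>, has dual gauge at most \<open>1\<close> and satisfies \<open>z y = \<parallel>y\<parallel>\<^sub>B\<close>: it
  is a certificate for \<open>y\<close>, as the characterization of the minimisers demands
  (\<open>certificate_at_fixed_point\<close>). Conversely a
  certificate for \<open>y\<close> makes \<open>y\<close> a minimiser for itself, because
  \<open>\<parallel>y\<parallel>\<^sub>B = z w + z (y - w) \<le> \<parallel>w\<parallel>\<^sub>B + t \<parallel>y - w\<parallel>\<close> for every \<open>w\<close> (\<open>certified_imp_minimizer\<close>).

  So \<open>\<pi>\<close> may fix every certified point and send any other point of \<open>B\<close> to an arbitrary minimiser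
  in \<open>B\<close>. Minimisers exist by compactness (\<open>K_real_attained\<close>). To avoid semicontinuity of the
  gauge, the minimum is taken over pairs \<open>(s, b)\<close> with \<open>b \<in> B\<close>, where the objective
  \<open>s + t \<parallel>x - s b\<parallel>\<close> is real-valued and continuous.
\<close>

section \<open>Sublinear functions and a supporting functional\<close>

text \<open>Homogeneity is only required as an inequality. The reverse inequality follows by rescaling,
  and the weaker form is the one that passes to infima directly.\<close>

definition sublinear :: "('a::real_vector \<Rightarrow> real) \<Rightarrow> bool" where
  "sublinear f \<longleftrightarrow> (\<forall>x y. f (x + y) \<le> f x + f y) \<and> (\<forall>c x. 0 \<le> c \<longrightarrow> f (c *\<^sub>R x) \<le> c * f x)"

lemma sublinear_add: "sublinear f \<Longrightarrow> f (x + y) \<le> f x + f y"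
  and sublinear_scale: "sublinear f \<Longrightarrow> 0 \<le> c \<Longrightarrow> f (c *\<^sub>R x) \<le> c * f x"
  by (auto simp: sublinear_def)

lemma sublinear_zero: "sublinear f \<Longrightarrow> f 0 = 0"
  using sublinear_add[of f 0 0] sublinear_scale[of f 0 0] by simp

lemma sublinear_scale_eq:
  assumes "sublinear f" "0 \<le> c"
  shows "f (c *\<^sub>R x) = c * f x"
proof (cases "c = 0")
  case False
  then have "0 < c" using assms(2) by simp
  have "f (inverse c *\<^sub>R (c *\<^sub>R x)) \<le> inverse c * f (c *\<^sub>R x)"
    using \<open>0 < c\<close> by (intro sublinear_scale assms) simp
  then have "c * f x \<le> f (c *\<^sub>R x)"
    using \<open>0 < c\<close> by (simp add: field_simps)
  then show ?thesis using sublinear_scale[OF assms, of x] by simp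
qed (simp add: sublinear_zero assms)

lemma sublinear_minus_le: "sublinear f \<Longrightarrow> - f (- x) \<le> f x"
  using sublinear_add[of f x "- x"] sublinear_zero[of f] by simp

text \<open>An infimum of functions is sublinear when the family is closed, up to domination, under
  addition and scaling of its members together with their arguments.\<close>

lemma sublinear_INF:
  fixes F :: "'i \<Rightarrow> 'a::real_vector \<Rightarrow> real"
  assumes ne: "I \<noteq> {}"
    and bdd: "\<And>x. bdd_below ((\<lambda>i. F i x) ` I)"
    and add: "\<And>i j x y. i \<in> I \<Longrightarrow> j \<in> I \<Longrightarrow> \<exists>k\<in>I. F k (x + y) \<le> F i x + F j y"
    and scale: "\<And>i c x. i \<in> I \<Longrightarrow> 0 \<le> c \<Longrightarrow> \<exists>k\<in>I. F k (c *\<^sub>R x) \<le> c * F i x"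
  shows "sublinear (\<lambda>x. INF i\<in>I. F i x)"
proof -
  define G where "G x = (INF i\<in>I. F i x)" for x
  have lower: "G x \<le> F i x" if "i \<in> I" for i x
    unfolding G_def by (rule cINF_lower[OF bdd that])
  have greatest: "m \<le> G x" if "\<And>i. i \<in> I \<Longrightarrow> m \<le> F i x" for m x
    unfolding G_def by (rule cINF_greatest[OF ne that])
  have "G (x + y) \<le> G x + G y" for x y
  proof -
    have "G (x + y) - G y \<le> F i x" if "i \<in> I" for i
    proof -
      have "G (x + y) - F i x \<le> F j y" if "j \<in> I" for j
      proof -
        obtain k where "k \<in> I" "F k (x + y) \<le> F i x + F j y"
          using add[OF \<open>i \<in> I\<close> \<open>j \<in> I\<close>] by blast
        then show ?thesis using lower[of k "x + y"] by simp
      qed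
      then have "G (x + y) - F i x \<le> G y" by (rule greatest)
      then show ?thesis by simp
    qed
    then have "G (x + y) - G y \<le> G x" by (rule greatest)
    then show ?thesis by simp
  qed
  moreover have "G (c *\<^sub>R x) \<le> c * G x" if "0 \<le> c" for c x
  proof -
    have le: "G (c *\<^sub>R x) \<le> c * F i x" if "i \<in> I" for i
      using scale[OF that \<open>0 \<le> c\<close>, of x] lower[of _ "c *\<^sub>R x"] by (meson order_trans)
    show ?thesis
    proof (cases "c = 0")
      case True
      then show ?thesis using le ne by auto
    next
      case False
      then have "0 < c" using that by simp
      then have "G (c *\<^sub>R x) / c \<le> G x"
        using le by (intro greatest) (simp add: field_simps)
      then show ?thesis using \<open>0 < c\<close> by (simp add: field_simps)
    qed
  qed
  ultimately show ?thesis by (simp add: sublinear_def G_def)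
qed

text \<open>The value at \<open>- a\<close> drops to \<open>- f a\<close>, the least that a sublinear function below \<open>f\<close> can take
  there. It is the device that replaces the one-dimensional extension step in the usual
  proof of the Hahn--Banach theorem.\<close>

definition descend :: "('a::real_vector \<Rightarrow> real) \<Rightarrow> 'a \<Rightarrow> 'a \<Rightarrow> real" where
  "descend f a x = (INF s\<in>{0..}. f (x + s *\<^sub>R a) - s * f a)"

lemma descend_bdd_below:
  assumes "sublinear f"
  shows "bdd_below ((\<lambda>s. f (x + s *\<^sub>R a) - s * f a) ` {0..})"
proof (rule bdd_belowI2)
  fix s :: real assume "s \<in> {0..}"
  then have "s * f a = f (s *\<^sub>R a)"
    using sublinear_scale_eq[OF assms] by simp
  also have "\<dots> \<le> f (x + s *\<^sub>R a) + f (- x)"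
    using sublinear_add[OF assms, of "x + s *\<^sub>R a" "- x"] by (simp add: algebra_simps)
  finally show "- f (- x) \<le> f (x + s *\<^sub>R a) - s * f a" by simp
qed

lemma descend_le:
  assumes "sublinear f" "0 \<le> s"
  shows "descend f a x \<le> f (x + s *\<^sub>R a) - s * f a"
  unfolding descend_def using assms(2) by (intro cINF_lower[OF descend_bdd_below[OF assms(1)]]) simp

lemma descend_le_self: "sublinear f \<Longrightarrow> descend f a x \<le> f x"
  using descend_le[of f 0 a x] by simp

lemma descend_minus_le: "sublinear f \<Longrightarrow> descend f a (- a) \<le> - f a"
  using descend_le[of f 1 a "- a"] sublinear_zero[of f] by simp

lemma sublinear_descend:
  assumes f: "sublinear f"
  shows "sublinear (descend f a)"
  unfolding descend_def
proof (rule sublinear_INF)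
  show "bdd_below ((\<lambda>s. f (x + s *\<^sub>R a) - s * f a) ` {0..})" for x
    by (rule descend_bdd_below[OF f])
next
  fix r s :: real and x y :: 'a assume "r \<in> {0..}" "s \<in> {0..}"
  moreover have "f (x + y + (r + s) *\<^sub>R a) - (r + s) * f a
      \<le> f (x + r *\<^sub>R a) - r * f a + (f (y + s *\<^sub>R a) - s * f a)"
    using sublinear_add[OF f, of "x + r *\<^sub>R a" "y + s *\<^sub>R a"] by (simp add: algebra_simps)
  ultimately show "\<exists>k\<in>{0..}. f (x + y + k *\<^sub>R a) - k * f a
      \<le> f (x + r *\<^sub>R a) - r * f a + (f (y + s *\<^sub>R a) - s * f a)"
    by (intro bexI[of _ "r + s"]) auto
next
  fix s c :: real and x :: 'a assume "s \<in> {0..}" "0 \<le> c"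
  moreover have "f (c *\<^sub>R x + (c * s) *\<^sub>R a) - (c * s) * f a \<le> c * (f (x + s *\<^sub>R a) - s * f a)"
    using sublinear_scale[OF f \<open>0 \<le> c\<close>, of "x + s *\<^sub>R a"] by (simp add: algebra_simps)
  ultimately show "\<exists>k\<in>{0..}. f (c *\<^sub>R x + k *\<^sub>R a) - k * f a \<le> c * (f (x + s *\<^sub>R a) - s * f a)"
    by (intro bexI[of _ "c * s"]) auto
qed simp

text \<open>Minimality forces \<open>descend m a = m\<close>, hence \<open>m (- a) \<le> - m a\<close> for every \<open>a\<close>. An odd sublinear
  function is linear.\<close>

lemma minimal_sublinear_is_linear:
  assumes m: "sublinear m"
    and minimal: "\<And>g. sublinear g \<Longrightarrow> g \<le> m \<Longrightarrow> g = m"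
  shows "linear m"
proof -
  have odd: "m (- a) = - m a" for a
  proof -
    have "descend m a = m"
      by (intro minimal sublinear_descend m le_funI descend_le_self)
    then have "m (- a) \<le> - m a"
      using descend_minus_le[OF m, of a] by simp
    then show ?thesis using sublinear_minus_le[OF m, of a] by simp
  qed
  show ?thesis
  proof (rule linearI)
    fix x y
    show "m (x + y) = m x + m y"
      using sublinear_add[OF m, of x y] sublinear_add[OF m, of "- x" "- y"] odd[of "x + y"]
      by (simp add: odd)
  next
    fix c x
    show "m (c *\<^sub>R x) = c *\<^sub>R m x"
    proof (cases "0 \<le> c")
      case False
      then have "m (- (c *\<^sub>R x)) = - c * m x"
        using sublinear_scale_eq[OF m, of "- c" x] by simp
      then show ?thesis by (simp add: odd)
    qed (simp add: sublinear_scale_eq[OF m])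
  qed
qed

text \<open>By Zorn's lemma applied to the reversed pointwise order. All sublinear functions below \<open>q\<close>
  stay above \<open>x \<mapsto> - q (- x)\<close>, so a nonempty chain of them has a pointwise infimum, which is again
  sublinear.\<close>

lemma ex_minimal_sublinear_below:
  fixes q :: "'a::real_vector \<Rightarrow> real"
  assumes q: "sublinear q"
  obtains m where "sublinear m" "m \<le> q" "\<And>g. sublinear g \<Longrightarrow> g \<le> m \<Longrightarrow> g = m"
proof -
  define A where "A = {f. sublinear f \<and> f \<le> q}"
  define P where "P f g \<longleftrightarrow> g \<le> f" for f g :: "'a \<Rightarrow> real"
  have "\<exists>m\<in>A. \<forall>g\<in>A. P m g \<longrightarrow> g = m"
  proof (rule predicate_Zorn)
    show "partial_order_on A (relation_of P A)"
      by (intro partial_order_on_relation_ofI) (auto simp: P_def)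
  next
    fix C assume C: "C \<in> Chains (relation_of P A)"
    then have CA: "C \<subseteq> A" and total: "\<And>f g. f \<in> C \<Longrightarrow> g \<in> C \<Longrightarrow> f \<le> g \<or> g \<le> f"
      by (auto simp: Chains_def relation_of_def P_def)
    show "\<exists>u\<in>A. \<forall>f\<in>C. P f u"
    proof (cases "C = {}")
      case True
      then show ?thesis using q by (auto simp: A_def)
    next
      case False
      have bdd: "bdd_below ((\<lambda>f. f x) ` C)" for x
      proof (rule bdd_belowI2)
        fix f assume "f \<in> C"
        then have "sublinear f" "f (- x) \<le> q (- x)" using CA by (auto simp: A_def le_fun_def)
        then show "- q (- x) \<le> f x" using sublinear_minus_le[of f x] by simp
      qed
      define u where "u x = (INF f\<in>C. f x)" for x
      have below: "u \<le> f" if "f \<in> C" for f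
        unfolding u_def by (intro le_funI cINF_lower[OF bdd that])
      have "sublinear u"
        unfolding u_def
      proof (rule sublinear_INF[OF False bdd])
        fix f g and x y :: 'a assume fg: "f \<in> C" "g \<in> C"
        then have sub: "sublinear f" "sublinear g" using CA by (auto simp: A_def)
        show "\<exists>k\<in>C. k (x + y) \<le> f x + g y"
        proof (cases "f \<le> g")
          case True
          then have "f (x + y) \<le> f x + g y"
            using sublinear_add[OF sub(1), of x y] le_funD[OF True, of y] by simp
          then show ?thesis using fg by blast
        next
          case False
          then have "g \<le> f" using total fg by blast
          then have "g (x + y) \<le> f x + g y"
            using sublinear_add[OF sub(2), of x y] le_funD[OF \<open>g \<le> f\<close>, of x] by simp
          then show ?thesis using fg by blast
        qed
      next
        fix f and c :: real and x :: 'a assume "f \<in> C" "0 \<le> c"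
        then show "\<exists>k\<in>C. k (c *\<^sub>R x) \<le> c * f x"
          using CA by (auto simp: A_def intro!: bexI[of _ f] sublinear_scale)
      qed
      moreover have "u \<le> q"
        using False below CA by (force simp: A_def intro: order_trans)
      ultimately show ?thesis using below by (auto simp: A_def P_def)
    qed
  qed
  then obtain m where "m \<in> A" and m: "\<And>g. g \<in> A \<Longrightarrow> g \<le> m \<Longrightarrow> g = m"
    by (auto simp: P_def)
  show thesis
  proof (rule that)
    show "sublinear m" "m \<le> q" using \<open>m \<in> A\<close> by (auto simp: A_def)
    then show "g = m" if "sublinear g" "g \<le> m" for g
      using that m by (auto simp: A_def intro: order_trans)
  qed
qed

text \<open>Descending at \<open>y\<close> before minimising gives \<open>z (- y) \<le> - q y\<close>, which makes the resulting
  linear functional touch \<open>q\<close> at \<open>y\<close>.\<close>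

lemma sublinear_has_supporting_functional:
  fixes q :: "'a::real_vector \<Rightarrow> real"
  assumes q: "sublinear q"
  obtains z where "linear z" "\<And>x. z x \<le> q x" "z y = q y"
proof -
  obtain z where z: "sublinear z" "z \<le> descend q y" "\<And>g. sublinear g \<Longrightarrow> g \<le> z \<Longrightarrow> g = z"
    using ex_minimal_sublinear_below[OF sublinear_descend[OF q]] by blast
  have lin: "linear z" by (rule minimal_sublinear_is_linear[OF z(1,3)])
  have le: "z x \<le> q x" for x
    using le_funD[OF z(2), of x] descend_le_self[OF q, of y x] by simp
  have "- z y \<le> - q y"
    using le_funD[OF z(2), of "- y"] descend_minus_le[OF q, of y] linear_neg[OF lin, of y] by simp
  then have "z y = q y" using le[of y] by simp
  then show thesis by (rule that[OF lin le])
qed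

section \<open>The functional as a real-valued infimum over pairs\<close>

lemma minkowski_gauge_le: "0 \<le> s \<Longrightarrow> b \<in> B \<Longrightarrow> minkowski_gauge B (s *\<^sub>R b) \<le> ereal s"
  unfolding minkowski_gauge_def by (rule Inf_lower) blast

lemma le_minkowski_gauge:
  "(\<And>s b. 0 \<le> s \<Longrightarrow> b \<in> B \<Longrightarrow> y = s *\<^sub>R b \<Longrightarrow> r \<le> ereal s) \<Longrightarrow> r \<le> minkowski_gauge B y"
  unfolding minkowski_gauge_def by (rule Inf_greatest) blast

lemma K_functional_le: "K_functional B t x \<le> minkowski_gauge B y + ereal (t * norm (x - y))"
  unfolding K_functional_def by (rule INF_lower) simp

text \<open>For nonempty \<open>B\<close> and \<open>t \<ge> 0\<close> this is \<open>K(t, x)\<close>: merging the infimum defining the gauge with the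
  infimum over \<open>y = s b\<close> removes the value \<open>\<infinity>\<close>.\<close>

definition K_real :: "'a::real_normed_vector set \<Rightarrow> real \<Rightarrow> 'a \<Rightarrow> real" where
  "K_real B t x = (INF (s, b)\<in>{0..} \<times> B. s + t * norm (x - s *\<^sub>R b))"

lemma K_real_bdd_below:
  assumes "0 \<le> t"
  shows "bdd_below ((\<lambda>(s, b). s + t * norm (x - s *\<^sub>R b)) ` ({0..} \<times> B))"
  using assms by (intro bdd_belowI2[of _ 0]) auto

lemma K_real_le:
  assumes "0 \<le> t" "0 \<le> s" "b \<in> B"
  shows "K_real B t x \<le> s + t * norm (x - s *\<^sub>R b)"
  unfolding K_real_def
  using cINF_lower[OF K_real_bdd_below[OF assms(1)], of "(s, b)"] assms by auto

lemma le_K_real: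
  assumes "B \<noteq> {}" "\<And>s b. 0 \<le> s \<Longrightarrow> b \<in> B \<Longrightarrow> r \<le> s + t * norm (x - s *\<^sub>R b)"
  shows "r \<le> K_real B t x"
  unfolding K_real_def using assms by (intro cINF_greatest) auto

lemma K_functional_eq_K_real:
  assumes "0 \<le> t" "B \<noteq> {}"
  shows "K_functional B t x = ereal (K_real B t x)"
proof -
  have ge: "ereal (K_real B t x) \<le> K_functional B t x"
    unfolding K_functional_def
  proof (rule INF_greatest)
    fix y
    have "ereal (K_real B t x - t * norm (x - y)) \<le> minkowski_gauge B y"
      by (rule le_minkowski_gauge) (use K_real_le[OF assms(1), of _ _ B x] in \<open>force simp: algebra_simps\<close>)
    then show "ereal (K_real B t x) \<le> minkowski_gauge B y + ereal (t * norm (x - y))"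
      by (cases "minkowski_gauge B y") auto
  qed
  have le: "K_functional B t x \<le> ereal (s + t * norm (x - s *\<^sub>R b))" if "0 \<le> s" "b \<in> B" for s b
    using order_trans[OF K_functional_le add_right_mono[OF minkowski_gauge_le[OF that]]] by simp
  obtain b where "b \<in> B" using assms(2) by blast
  then obtain k where k: "K_functional B t x = ereal k"
    using ge le[of 0 b] by (cases "K_functional B t x") auto
  have "k \<le> K_real B t x"
    using le by (intro le_K_real assms(2)) (simp add: k)
  then show ?thesis using ge k by simp
qed

text \<open>Convexity enters here: \<open>s b + r c\<close> is \<open>s + r\<close> times a point of \<open>B\<close>.\<close>

lemma sublinear_K_real:
  assumes t: "0 \<le> t" and ne: "B \<noteq> {}" and conv: "convex B"
  shows "sublinear (K_real B t)"
proof -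
  define F where "F p x = fst p + t * norm (x - fst p *\<^sub>R snd p)" for p :: "real \<times> 'a" and x
  have "sublinear (\<lambda>x. INF p\<in>{0..} \<times> B. F p x)"
  proof (rule sublinear_INF)
    show "bdd_below ((\<lambda>p. F p x) ` ({0..} \<times> B))" for x
      using K_real_bdd_below[OF t, of x B] by (simp add: F_def case_prod_unfold)
    show "{0::real..} \<times> B \<noteq> {}" using ne by auto
  next
    fix i j :: "real \<times> 'a" and x y assume ij: "i \<in> {0..} \<times> B" "j \<in> {0..} \<times> B"
    obtain s b r c where [simp]: "i = (s, b)" "j = (r, c)" by (cases i, cases j)
    have h: "0 \<le> s" "0 \<le> r" "b \<in> B" "c \<in> B" using ij by auto
    obtain d where d: "d \<in> B" "(s + r) *\<^sub>R d = s *\<^sub>R b + r *\<^sub>R c"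
    proof (cases "s + r = 0")
      case True
      then have "s = 0" "r = 0" using h by auto
      then show ?thesis using h(3) by (intro that[of b]) auto
    next
      case False
      then have "0 < s + r" using h by simp
      show ?thesis
      proof (rule that)
        have "s / (s + r) + r / (s + r) = 1"
          using False by (simp flip: add_divide_distrib)
        then show "(s / (s + r)) *\<^sub>R b + (r / (s + r)) *\<^sub>R c \<in> B"
          using \<open>0 < s + r\<close> h by (intro convexD[OF conv]) auto
        show "(s + r) *\<^sub>R ((s / (s + r)) *\<^sub>R b + (r / (s + r)) *\<^sub>R c) = s *\<^sub>R b + r *\<^sub>R c"
          using False by (simp add: scaleR_add_right)
      qed
    qed
    have "norm (x + y - (s + r) *\<^sub>R d) \<le> norm (x - s *\<^sub>R b) + norm (y - r *\<^sub>R c)"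
      unfolding d(2) by (rule norm_diff_triangle_ineq)
    then have "t * norm (x + y - (s + r) *\<^sub>R d) \<le> t * norm (x - s *\<^sub>R b) + t * norm (y - r *\<^sub>R c)"
      using mult_left_mono[OF _ t] by (fastforce simp flip: distrib_left)
    then show "\<exists>k\<in>{0..} \<times> B. F k (x + y) \<le> F i x + F j y"
      using h d(1) by (intro bexI[of _ "(s + r, d)"]) (auto simp: F_def)
  next
    fix i :: "real \<times> 'a" and c :: real and x assume i: "i \<in> {0..} \<times> B" and c: "0 \<le> c"
    have "norm (c *\<^sub>R x - (c * fst i) *\<^sub>R snd i) = c * norm (x - fst i *\<^sub>R snd i)"
      using c norm_scaleR[of c "x - fst i *\<^sub>R snd i"] by (simp add: scaleR_diff_right)
    then show "\<exists>k\<in>{0..} \<times> B. F k (c *\<^sub>R x) \<le> c * F i x"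
      using i c by (intro bexI[of _ "(c * fst i, snd i)"]) (auto simp: F_def algebra_simps)
  qed
  moreover have "K_real B t = (\<lambda>x. INF p\<in>{0..} \<times> B. F p x)"
    by (rule ext) (simp add: K_real_def F_def case_prod_unfold)
  ultimately show ?thesis by simp
qed

section \<open>Minimisers and certificates\<close>

text \<open>On the compact set \<open>[0, 1] \<times> B\<close> the continuous objective has a minimum. Pairs with \<open>s > 1\<close>
  cannot do better, since the pair \<open>(1, x)\<close> already has value \<open>1\<close>.\<close>

lemma K_real_attained:
  assumes t: "0 \<le> t" and B: "compact B" and x: "x \<in> B"
  obtains s b where "0 \<le> s" "s \<le> 1" "b \<in> B" "K_real B t x = s + t * norm (x - s *\<^sub>R b)"
proof -
  define g where "g p = fst p + t * norm (x - fst p *\<^sub>R snd p)" for p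
  have "continuous_on ({0..1} \<times> B) g"
    unfolding g_def by (intro continuous_intros)
  then obtain p where p: "p \<in> {0..1} \<times> B" "\<And>p'. p' \<in> {0..1} \<times> B \<Longrightarrow> g p \<le> g p'"
    using continuous_attains_inf[of "{0..1} \<times> B" g] compact_Times[OF compact_Icc B] x by fastforce
  obtain s b where [simp]: "p = (s, b)" by (cases p)
  have sb: "0 \<le> s" "s \<le> 1" "b \<in> B" using p(1) by auto
  have "g p \<le> s' + t * norm (x - s' *\<^sub>R b')" if "0 \<le> s'" "b' \<in> B" for s' b'
  proof (cases "s' \<le> 1")
    case True
    then show ?thesis using p(2)[of "(s', b')"] that by (simp add: g_def)
  next
    case False
    have "g p \<le> 1" using p(2)[of "(1, x)"] x by (simp add: g_def)
    also have "1 \<le> s' + t * norm (x - s' *\<^sub>R b')" using False t by (simp add: add_increasing2)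
    finally show ?thesis .
  qed
  then have "g p \<le> K_real B t x" using x by (intro le_K_real) auto
  moreover have "K_real B t x \<le> g p" using K_real_le[OF t sb(1,3)] by (simp add: g_def)
  ultimately show thesis using sb by (intro that[of s b]) (auto simp: g_def)
qed

text \<open>For an optimal pair \<open>(s, b)\<close>, a representation of \<open>y = s b\<close> with a smaller factor would lower the
  objective, so \<open>s\<close> is the gauge of \<open>y\<close>. The triangle inequality transfers optimality from \<open>x\<close>
  to \<open>y\<close>.\<close>

lemma ex_minimizer_fixed:
  assumes t: "0 \<le> t" and B: "compact B" "convex B" "0 \<in> B" and x: "x \<in> B"
  obtains y where "y \<in> B"
    "K_functional B t x = minkowski_gauge B y + ereal (t * norm (x - y))"
    "minkowski_gauge B y = ereal (K_real B t y)"
proof -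
  obtain s b where sb: "0 \<le> s" "s \<le> 1" "b \<in> B"
    and opt: "K_real B t x = s + t * norm (x - s *\<^sub>R b)"
    using K_real_attained[OF t B(1) x] .
  define y where "y = s *\<^sub>R b"
  have ne: "B \<noteq> {}" using x by auto
  have "y \<in> B"
    using convexD[OF B(2) sb(3) B(3), of s "1 - s"] sb by (simp add: y_def)
  have gauge: "minkowski_gauge B y = ereal s"
  proof (rule antisym)
    show "minkowski_gauge B y \<le> ereal s"
      unfolding y_def using sb by (intro minkowski_gauge_le)
    show "ereal s \<le> minkowski_gauge B y"
    proof (rule le_minkowski_gauge)
      fix s' b' assume "0 \<le> s'" "b' \<in> B" "y = s' *\<^sub>R b'"
      then show "ereal s \<le> ereal s'"
        using K_real_le[OF t, of s' b' B x] opt by (simp flip: y_def)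
    qed
  qed
  have "K_real B t y = s"
  proof (rule antisym)
    show "K_real B t y \<le> s"
      using K_real_le[OF t sb(1,3), of y] by (simp add: y_def)
    show "s \<le> K_real B t y"
    proof (rule le_K_real[OF ne])
      fix s' :: real and b' assume h: "0 \<le> s'" "b' \<in> B"
      have "norm (x - s' *\<^sub>R b') \<le> norm (x - y) + norm (y - s' *\<^sub>R b')"
        using norm_triangle_ineq[of "x - y" "y - s' *\<^sub>R b'"] by simp
      then have "t * norm (x - s' *\<^sub>R b') \<le> t * norm (x - y) + t * norm (y - s' *\<^sub>R b')"
        using mult_left_mono[OF _ t] by (fastforce simp flip: distrib_left)
      then show "s \<le> s' + t * norm (y - s' *\<^sub>R b')"
        using K_real_le[OF t h, of x] opt by (simp flip: y_def)
    qed
  qed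
  then show thesis
    using \<open>y \<in> B\<close> gauge opt K_functional_eq_K_real[OF t ne, of x] by (intro that) (auto simp: y_def)
qed

text \<open>The supporting functional of \<open>K(t, \<cdot>)\<close> at \<open>y\<close>. The pairs \<open>(0, b)\<close> bound it by \<open>t \<parallel>\<cdot>\<parallel>\<close>, which also
  makes it continuous, and the pairs \<open>(1, b)\<close> bound it by \<open>1\<close> on \<open>B\<close>.\<close>

lemma certificate_at_fixed_point:
  fixes B :: "'a::real_normed_vector set"
  assumes t: "0 \<le> t" and B: "convex B" "B \<noteq> {}"
    and y: "minkowski_gauge B y = ereal (K_real B t y)"
  shows "\<exists>z :: 'a \<Rightarrow>\<^sub>L real.
    ereal (blinfun_apply z y) = minkowski_gauge B y \<and> dual_gauge B z \<le> 1 \<and> norm z \<le> t"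
proof -
  obtain f where lin: "linear f" and le: "\<And>x. f x \<le> K_real B t x" and fy: "f y = K_real B t y"
    using sublinear_has_supporting_functional[OF sublinear_K_real[OF t B(2,1)]] by blast
  obtain b where "b \<in> B" using B(2) by blast
  have "f x \<le> t * norm x" for x
    using le[of x] K_real_le[OF t _ \<open>b \<in> B\<close>, of 0 x] by simp
  from this this[of "- x" for x] have bound: "norm (f x) \<le> t * norm x" for x
    by (simp add: abs_le_iff linear_neg[OF lin])
  have "bounded_linear f"
    by (intro bounded_linear_intro[where K = t])
       (use bound in \<open>auto simp: linear_add[OF lin] linear_scale[OF lin] mult.commute\<close>)
  then have apply_z: "blinfun_apply (Blinfun f) = f" by (rule bounded_linear_Blinfun_apply)
  have "norm (Blinfun f) \<le> t"
    by (rule norm_blinfun_bound[OF t]) (use bound in \<open>simp add: apply_z\<close>)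
  moreover have "f x \<le> 1" if "x \<in> B" for x
    using le[of x] K_real_le[OF t _ that, of 1 x] by simp
  then have "dual_gauge B (Blinfun f) \<le> 1"
    unfolding dual_gauge_def apply_z by (intro SUP_least) simp
  ultimately show ?thesis using fy y by (intro exI[of _ "Blinfun f"]) (simp add: apply_z)
qed

lemma certified_imp_minimizer:
  fixes z :: "'a::real_normed_vector \<Rightarrow>\<^sub>L real"
  assumes zy: "ereal (blinfun_apply z y) = minkowski_gauge B y"
    and dual: "dual_gauge B z \<le> 1" and norm: "norm z \<le> t"
  shows "K_functional B t y = minkowski_gauge B y"
proof (rule antisym)
  show "K_functional B t y \<le> minkowski_gauge B y"
    using K_functional_le[of B t y y] by (simp flip: zero_ereal_def)
  show "minkowski_gauge B y \<le> K_functional B t y"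
    unfolding K_functional_def
  proof (rule INF_greatest)
    fix w
    have gauge: "ereal (z w) \<le> minkowski_gauge B w"
    proof (rule le_minkowski_gauge)
      fix s b assume h: "0 \<le> s" "b \<in> B" "w = s *\<^sub>R b"
      have "ereal (z b) \<le> 1"
        using SUP_upper[OF h(2), of "\<lambda>x. ereal (z x)"] dual unfolding dual_gauge_def by (rule order_trans)
      then have "s * z b \<le> s * 1" using h(1) by (intro mult_left_mono) auto
      then show "ereal (z w) \<le> ereal s" by (simp add: h(3) blinfun.scaleR_right)
    qed
    have "z (y - w) \<le> norm z * norm (y - w)" using norm_blinfun[of z "y - w"] by simp
    also have "\<dots> \<le> t * norm (y - w)" using norm by (intro mult_right_mono) auto
    finally have "ereal (z y) \<le> ereal (z w) + ereal (t * norm (y - w))"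
      by (simp add: blinfun.diff_right)
    also have "\<dots> \<le> minkowski_gauge B w + ereal (t * norm (y - w))"
      by (rule add_right_mono[OF gauge])
    finally show "minkowski_gauge B y \<le> minkowski_gauge B w + ereal (t * norm (y - w))"
      by (simp add: zy)
  qed
qed

theorem proposition2p5:
  fixes B :: "'a::banach set" and t :: real
  assumes "\<And>x. x \<in> B \<Longrightarrow> - x \<in> B"
    and "compact B"
    and "convex B"
    and "0 \<le> t"
  shows "\<exists>\<pi> :: 'a \<Rightarrow> 'a. \<pi> ` B \<subseteq> B
    \<and> (\<forall>x\<in>B. K_functional B t x = minkowski_gauge B (\<pi> x) + ereal (t * norm (x - \<pi> x)))
    \<and> \<pi> ` B = {y \<in> B. \<exists>z :: 'a \<Rightarrow>\<^sub>L real.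
          ereal (blinfun_apply z y) = minkowski_gauge B y \<and> dual_gauge B z \<le> 1 \<and> norm z \<le> t}
    \<and> (\<forall>x \<in> \<pi> ` B. \<pi> x = x)"
proof -
  define S where "S = {y \<in> B. \<exists>z :: 'a \<Rightarrow>\<^sub>L real.
    ereal (blinfun_apply z y) = minkowski_gauge B y \<and> dual_gauge B z \<le> 1 \<and> norm z \<le> t}"
  define M where "M x y \<longleftrightarrow>
    K_functional B t x = minkowski_gauge B y + ereal (t * norm (x - y))" for x y
  have ex: "\<exists>y\<in>S. M x y" if x: "x \<in> B" for x
  proof -
    have "0 \<in> B"
      using convexD[OF assms(3) x assms(1)[OF x], of "1/2" "1/2"] by simp
    then obtain y where y: "y \<in> B" "M x y" "minkowski_gauge B y = ereal (K_real B t y)"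
      using ex_minimizer_fixed[OF assms(4,2,3) _ x] unfolding M_def by blast
    then have "y \<in> S"
      using certificate_at_fixed_point[OF assms(4,3) _ y(3)] by (auto simp: S_def)
    then show ?thesis using y(2) by blast
  qed
  have self: "M x x" if "x \<in> S" for x
    using that certified_imp_minimizer[of _ x B t] by (auto simp: S_def M_def simp flip: zero_ereal_def)
  define \<pi> where "\<pi> x = (if x \<in> S then x else SOME y. y \<in> S \<and> M x y)" for x
  have pi: "\<pi> x \<in> S \<and> M x (\<pi> x)" if "x \<in> B" for x
    using someI_ex[of "\<lambda>y. y \<in> S \<and> M x y"] ex[OF that] self by (auto simp: \<pi>_def)
  have "S \<subseteq> B" by (auto simp: S_def)
  then have "\<pi> ` B = S" using pi by (force simp: \<pi>_def)
  moreover have "\<forall>x\<in>S. \<pi> x = x" by (simp add: \<pi>_def)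
  ultimately have "\<pi> ` B \<subseteq> B \<and> (\<forall>x\<in>B. M x (\<pi> x)) \<and> \<pi> ` B = S \<and> (\<forall>x\<in>\<pi> ` B. \<pi> x = x)"
    using \<open>S \<subseteq> B\<close> pi by simp
  then show ?thesis unfolding M_def S_def by blast
qed

end
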